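(* Let $q$ be a prime power, $n,r$ integers with $r\le\lfloor n/2\rfloor$, and $0\le u,s\le r$, $1\le d\le r$. Let ${\bf X} = ({\bf A}\mid{\bf B})\in\mathrm{GF}(q)^{r\times n}$ with ${\bf A}$ having $r$ columns and ${\bf B}$ having $n-r$ columns, and write ${\bf A} = ({\bf A}_1\mid{\bf a}\mid{\bf A}_2)$, ${\bf B}=({\bf B}_1\mid{\bf b}\mid{\bf B}_2)$, where ${\bf a}$ and ${\bf b}$ are the $d$-th columns of ${\bf A}$ and ${\bf B}$ respectively. Then ${\bf X}\in F(u,s,d)$ if and only if $\mathrm{rk}({\bf X}) = r$, $\mathrm{rk}({\bf B})\le u$, and $\mathrm{rk}({\bf B}_1-{\bf A}_1\mid{\bf b}-{\bf a}\mid{\bf B}_2)\le s$.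
   Context: $E_r(q,n)$ is the set of $r$-dimensional subspaces of $\mathrm{GF}(q)^n$ with injection distance $d_{\mathrm{I}}(U,V)=\dim(U+V)-\min\{\dim U,\dim V\}$; $B_t(U)=\{V\in E_r(q,n): d_{\mathrm{I}}(U,V)\le t\}$; $R({\bf M})$ is the row space of ${\bf M}$. For $0\le d\le r$, ${\bf P}_d\in\mathrm{GF}(q)^{r\times(n-r)}$ is the matrix with ${\bf I}_d$ in its top-left $d\times d$ block and zeros elsewhere, and $U_d = R({\bf I}_r\mid{\bf P}_d)$. $F(u,s,d)$ is the set of all matrices in $\mathrm{GF}(q)^{r\times n}$ of rank $r$ whose row space lies in $B_u(U_0)\cap B_s(U_d)$. *)

theory Defs
  imports "Jordan_Normal_Form.DL_Rank"
begin

text \<open>Vectors of GF(q)^n are 'a vec in carrier_vec n, for a finite field type 'a.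
  Subspaces are subspaces (HOL-Algebra/VectorSpace sense) of module_vec TYPE('a) n.\<close>

definition is_subspace :: "nat \<Rightarrow> 'a::field vec set \<Rightarrow> bool" where
  "is_subspace n W = subspace class_ring W (module_vec TYPE('a) n)"

definition subdim :: "nat \<Rightarrow> 'a::field vec set \<Rightarrow> nat" where
  "subdim n W = vectorspace.dim class_ring ((module_vec TYPE('a) n)\<lparr>carrier := W\<rparr>)"

definition subspace_plus :: "'a::field vec set \<Rightarrow> 'a vec set \<Rightarrow> 'a vec set" where
  "subspace_plus U V = {u + v | u v. u \<in> U \<and> v \<in> V}"

text \<open>Injection distance d_I(U,V) = dim(U+V) - min(dim U, dim V).\<close>
definition inj_dist :: "nat \<Rightarrow> 'a::field vec set \<Rightarrow> 'a vec set \<Rightarrow> nat" where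
  "inj_dist n U V = subdim n (subspace_plus U V) - min (subdim n U) (subdim n V)"

text \<open>E_r(q,n): the r-dimensional subspaces of GF(q)^n.\<close>
definition Grass :: "nat \<Rightarrow> nat \<Rightarrow> 'a::field vec set set" where
  "Grass r n = {W. is_subspace n W \<and> subdim n W = r}"

text \<open>B_t(U) inside E_r(q,n).\<close>
definition inj_ball :: "nat \<Rightarrow> nat \<Rightarrow> nat \<Rightarrow> 'a::field vec set \<Rightarrow> 'a vec set set" where
  "inj_ball r n t U = {V \<in> Grass r n. inj_dist n U V \<le> t}"

text \<open>Row space R(M) of a matrix with n columns, and rank.\<close>
definition row_sp :: "nat \<Rightarrow> 'a::field mat \<Rightarrow> 'a vec set" where
  "row_sp n M = vec_space.row_space n M"

definition rk :: "'a::field mat \<Rightarrow> nat" where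
  "rk M = vec_space.rank (dim_row M) M"

text \<open>Horizontal concatenation (A | B) and column slices.\<close>
definition hconcat :: "'a mat \<Rightarrow> 'a mat \<Rightarrow> 'a mat" where
  "hconcat A B = mat (dim_row A) (dim_col A + dim_col B)
     (\<lambda>(i,j). if j < dim_col A then A $$ (i,j) else B $$ (i, j - dim_col A))"

text \<open>Columns i, ..., j-1 of M (0-indexed).\<close>
definition col_slice :: "'a mat \<Rightarrow> nat \<Rightarrow> nat \<Rightarrow> 'a mat" where
  "col_slice M i j = mat (dim_row M) (j - i) (\<lambda>(k,l). M $$ (k, i + l))"

text \<open>P_d: r x (n-r) matrix with I_d in the top-left d x d block, zeros elsewhere.\<close>
definition P_mat :: "nat \<Rightarrow> nat \<Rightarrow> nat \<Rightarrow> 'a::field mat" where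
  "P_mat r n d = mat r (n - r) (\<lambda>(i,j). if i = j \<and> i < d then 1 else 0)"

text \<open>U_d = R(I_r | P_d).\<close>
definition U_sub :: "nat \<Rightarrow> nat \<Rightarrow> nat \<Rightarrow> 'a::field vec set" where
  "U_sub r n d = row_sp n (hconcat (1\<^sub>m r) (P_mat r n d))"

text \<open>F(u,s,d): rank-r matrices in GF(q)^{r x n} whose row space lies in B_u(U_0) \<inter> B_s(U_d).\<close>
definition F_set :: "nat \<Rightarrow> nat \<Rightarrow> nat \<Rightarrow> nat \<Rightarrow> nat \<Rightarrow> 'a::field mat set" where
  "F_set r n u s d = {X \<in> carrier_mat r n. rk X = r \<and>
      row_sp n X \<in> inj_ball r n u (U_sub r n 0) \<inter> inj_ball r n s (U_sub r n d)}"

end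

theory Submission
  imports Defs "Jordan_Normal_Form.Matrix_Kernel"
begin

text \<open>Let H_d be the (n-r) x n matrix (-P_d^T | I_{n-r}). Its kernel is exactly U_d, so by
  rank-nullity for v \<mapsto> H_d v on U_d + R(X) we get dim(U_d + R(X)) = r + dim H_d(R(X)) =
  r + rk(X H_d^T). For rk X = r this says d_I(U_d, R(X)) = rk(X H_d^T). Finally X H_0^T = B and
  X H_d^T = (B_1 - A_1 | b - a | B_2), since column j of X H_d^T is column r + j of X minus,
  for j < d, column j of X.\<close>

lemma (in vec_space) span_subspace_eq:
  assumes "subspace class_ring W V"
  shows "span W = W"
proof
  have sm: "submodule class_ring W V" using assms unfolding subspace_def by simp
  show "span W \<subseteq> W" by (rule span_is_subset[OF subset_refl sm])
  have "W \<subseteq> carrier V" using sm unfolding submodule_def by simp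
  then show "W \<subseteq> span W" using in_own_span[of W] by simp
qed

lemma finite_carrier_vec: "finite (carrier_vec n :: 'a::finite vec set)"
proof -
  have "carrier_vec n \<subseteq> (\<lambda>f. vec n f) ` ({0..<n} \<rightarrow>\<^sub>E (UNIV :: 'a set))"
  proof
    fix v :: "'a vec" assume "v \<in> carrier_vec n"
    then have "v = vec n (restrict (($) v) {0..<n})" by (intro eq_vecI) auto
    then show "v \<in> (\<lambda>f. vec n f) ` ({0..<n} \<rightarrow>\<^sub>E UNIV)"
      by (rule image_eqI[where f="\<lambda>f. vec n f"]) simp
  qed
  then show ?thesis by (rule finite_subset) (intro finite_imageI finite_PiE, auto)
qed

lemma fin_dim_subspace:
  fixes W :: "'a::{finite,field} vec set"
  assumes "is_subspace n W"
  shows "vectorspace.fin_dim class_ring ((module_vec TYPE('a) n)\<lparr>carrier := W\<rparr>)"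
proof -
  interpret vec_space "TYPE('a)" n .
  have W: "subspace class_ring W V" using assms unfolding is_subspace_def .
  then have "W \<subseteq> carrier_vec n" unfolding subspace_def submodule_def by simp
  then have "finite W" using finite_carrier_vec finite_subset by blast
  with fin_dim_span \<open>W \<subseteq> carrier_vec n\<close> span_subspace_eq[OF W] show ?thesis by fastforce
qed

lemma subspace_subset_carrier: "is_subspace n W \<Longrightarrow> W \<subseteq> carrier_vec n"
  unfolding is_subspace_def subspace_def submodule_def by (auto simp: module_vec_simps)

lemma zero_in_subspace: "is_subspace n W \<Longrightarrow> 0\<^sub>v n \<in> W"
  unfolding is_subspace_def subspace_def submodule_def by (auto simp: module_vec_simps)

lemma is_subspace_carrier_vec: "is_subspace n (carrier_vec n :: 'a::field vec set)"
proof -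
  interpret vec_space "TYPE('a)" n .
  have "set (unit_vecs n) \<subseteq> carrier_vec n" by (auto simp: unit_vecs_def)
  from span_is_subspace[OF this] show ?thesis
    unfolding is_subspace_def span_unit_vecs_is_carrier .
qed

lemma is_subspace_subspace_plus:
  assumes "is_subspace n (U :: 'a::field vec set)" "is_subspace n W"
  shows "is_subspace n (subspace_plus U W)"
proof -
  interpret vec_space "TYPE('a)" n .
  have "subspace_plus U W = submodule_sum U W"
    unfolding subspace_plus_def submodule_sum_def by auto
  then show ?thesis using sum_is_subspace assms unfolding is_subspace_def by simp
qed

lemma subdim_carrier_vec: "subdim n (carrier_vec n :: 'a::field vec set) = n"
proof -
  interpret vec_space "TYPE('a)" n .
  have "vs (carrier_vec n) = V" by (simp add: module_vec_def)
  then show ?thesis unfolding subdim_def using dim_is_n by metis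
qed

lemma subdim_mono:
  assumes "is_subspace n (U :: 'a::{finite,field} vec set)" "is_subspace n W" "U \<subseteq> W"
  shows "subdim n U \<le> subdim n W"
proof -
  interpret vec_space "TYPE('a)" n .
  have U: "subspace class_ring U V" and W: "subspace class_ring W V"
    using assms unfolding is_subspace_def by auto
  have "vectorspace.dim class_ring ((vs W)\<lparr>carrier := U\<rparr>) \<le> vectorspace.dim class_ring (vs W)"
    using vectorspace.subspace_dim[OF subspace_is_vs[OF W] nested_subspaces[OF W U assms(3)]
        fin_dim_subspace[OF assms(2)]] fin_dim_subspace[OF assms(1)] by simp
  then show ?thesis unfolding subdim_def by simp
qed

lemma subdim_mat_image_plus_kernel:
  fixes H :: "'a::{finite,field} mat"
  assumes H: "H \<in> carrier_mat m n" and W: "is_subspace n W"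
  shows "subdim m ((*\<^sub>v) H ` W) + subdim n {v \<in> W. H *\<^sub>v v = 0\<^sub>v m} = subdim n W"
proof -
  interpret N: vec_space "TYPE('a)" n .
  interpret M: vec_space "TYPE('a)" m .
  have sub: "subspace class_ring W N.V" using W unfolding is_subspace_def .
  have vsW: "vectorspace class_ring (N.vs W)" by (rule N.subspace_is_vs[OF sub])
  have Wc: "W \<subseteq> carrier_vec n" using subspace_subset_carrier[OF W] .
  have "(*\<^sub>v) H \<in> LinearCombinations.module_hom class_ring (N.vs W) M.V"
    unfolding LinearCombinations.module_hom_def
  proof (intro CollectI conjI allI impI)
    show "(*\<^sub>v) H \<in> carrier (N.vs W) \<rightarrow> carrier M.V" using Wc H by auto
    fix x y assume "x \<in> carrier (N.vs W) \<and> y \<in> carrier (N.vs W)"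
    then show "H *\<^sub>v (x \<oplus>\<^bsub>N.vs W\<^esub> y) = H *\<^sub>v x \<oplus>\<^bsub>M.V\<^esub> H *\<^sub>v y"
      using Wc mult_add_distrib_mat_vec[OF H] by (auto simp: module_vec_simps)
  next
    fix c :: 'a and x assume "c \<in> carrier class_ring \<and> x \<in> carrier (N.vs W)"
    then show "H *\<^sub>v (c \<odot>\<^bsub>N.vs W\<^esub> x) = c \<odot>\<^bsub>M.V\<^esub> (H *\<^sub>v x)"
      using Wc H by (auto simp: module_vec_simps mult_mat_vec)
  qed
  then have lm: "linear_map class_ring (N.vs W) M.V ((*\<^sub>v) H)"
    by (intro linear_map.intro vsW M.vectorspace_axioms mod_hom.intro mod_hom_axioms.intro
        vectorspace.axioms(1)[OF vsW] M.module_axioms)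
  have hom: "mod_hom class_ring (N.vs W) M.V ((*\<^sub>v) H)" using linear_map.axioms(3)[OF lm] .
  show ?thesis
    using linear_map.rank_nullity[OF lm fin_dim_subspace[OF W]]
    unfolding mod_hom.im_def[OF hom] mod_hom.ker_def[OF hom] subdim_def by simp
qed

definition mat_image :: "'a::field mat \<Rightarrow> 'a vec set" where
  "mat_image M = (*\<^sub>v) M ` carrier_vec (dim_col M)"

lemma col_space_eq_mat_image: "vec_space.col_space (dim_row M) M = mat_image M"
proof -
  interpret vec_space "TYPE('a)" "dim_row M" .
  have "M \<in> carrier_mat (dim_row M) (dim_col M)" by simp
  then have "col_space M = {y \<in> carrier_vec (dim_row M). \<exists>x\<in>carrier_vec (dim_col M). M *\<^sub>v x = y}"
    by (rule col_space_eq)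
  also have "\<dots> = mat_image M"
  proof -
    have "M *\<^sub>v x \<in> carrier_vec (dim_row M)" for x by (simp add: carrier_vecI)
    then show ?thesis unfolding mat_image_def by blast
  qed
  finally show ?thesis .
qed

lemma is_subspace_mat_image: "is_subspace (dim_row M) (mat_image (M :: 'a::field mat))"
proof -
  interpret vec_space "TYPE('a)" "dim_row M" .
  have "set (cols M) \<subseteq> carrier_vec (dim_row M)" by (auto simp: cols_def)
  from span_is_subspace[OF this] show ?thesis
    unfolding is_subspace_def col_space_eq_mat_image[symmetric] col_space_def by simp
qed

lemma rk_eq_subdim_mat_image: "rk M = subdim (dim_row M) (mat_image M)"
proof -
  interpret vec_space "TYPE('a)" "dim_row M" .
  show ?thesis
    unfolding rk_def rank_def subdim_def col_space_eq_mat_image[symmetric] col_space_def by simp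
qed

lemma row_sp_eq_mat_image_transpose:
  assumes "X \<in> carrier_mat r n"
  shows "row_sp n X = mat_image X\<^sup>T"
proof -
  interpret vec_space "TYPE('a)" n .
  show ?thesis using assms col_space_eq_mat_image[of "X\<^sup>T"]
    unfolding row_sp_def row_space_eq_col_space_transpose by simp
qed

lemma mat_image_mult_subset:
  assumes "A \<in> carrier_mat m k" "B \<in> carrier_mat k l"
  shows "mat_image (A * B) \<subseteq> mat_image A"
proof
  fix y assume "y \<in> mat_image (A * B)"
  then obtain x where x: "x \<in> carrier_vec l" and y: "y = A * B *\<^sub>v x"
    unfolding mat_image_def using assms by auto
  have "y = A *\<^sub>v (B *\<^sub>v x)" unfolding y using assms x by (simp add: assoc_mult_mat_vec)
  moreover have "B *\<^sub>v x \<in> carrier_vec (dim_col A)" using assms x by simp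
  ultimately show "y \<in> mat_image A" unfolding mat_image_def by blast
qed

lemma (in vec_space) col_space_basis_mat:
  assumes M: "M \<in> carrier_mat n k"
  obtains C where "C \<in> carrier_mat n (rank M)" "col_space C = col_space M"
proof -
  have colsM: "set (cols M) \<subseteq> carrier_vec n" using M by (auto simp: cols_def)
  let ?S = "col_space M"
  have subS: "subspace class_ring ?S V" unfolding col_space_def by (rule span_is_subspace[OF colsM])
  then have smS: "submodule class_ring ?S V" unfolding subspace_def by simp
  have vsS: "vectorspace class_ring (vs ?S)" by (rule subspace_is_vs[OF subS])
  obtain b where fb: "finite b" and bb: "vectorspace.basis class_ring (vs ?S) b"
    using vectorspace.finite_basis_exists[OF vsS fin_dim_span_cols[OF M, folded col_space_def]]
    by blast
  have "rank M = card b"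
    using vectorspace.dim_basis[OF vsS fb bb] unfolding rank_def col_space_def by simp
  moreover have bS: "b \<subseteq> ?S" and "LinearCombinations.module.span class_ring (vs ?S) b = ?S"
    using bb unfolding vectorspace.basis_def[OF vsS] by auto
  moreover obtain bs where bs: "set bs = b" "distinct bs" using finite_distinct_list[OF fb] by blast
  moreover have "card b = length bs" using distinct_card[OF bs(2)] bs(1) by simp
  moreover have "set bs \<subseteq> carrier_vec n" using bS smS bs(1) unfolding submodule_def by auto
  ultimately show ?thesis
    using that[of "mat_of_cols n bs"] span_li_not_depend(1)[OF bS smS]
    unfolding col_space_def by (simp add: cols_mat_of_cols)
qed

lemma rank_factorization:
  fixes M :: "'a::field mat"
  assumes M: "M \<in> carrier_mat m k"
  obtains C W where "C \<in> carrier_mat m (rk M)" "W \<in> carrier_mat (rk M) k" "M = C * W"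
proof -
  interpret vec_space "TYPE('a)" m .
  have "rk M = rank M" using M unfolding rk_def by simp
  then obtain C where C: "C \<in> carrier_mat m (rk M)" and CM: "col_space C = col_space M"
    using col_space_basis_mat[OF M] by metis
  have "\<exists>x\<in>carrier_vec (rk M). C *\<^sub>v x = col M j" if j: "j < k" for j
  proof -
    have "set (cols M) \<subseteq> carrier_vec m" using M by (auto simp: cols_def)
    moreover have "col M j \<in> set (cols M)" using j M by (auto simp: cols_def)
    ultimately have "col M j \<in> col_space M" unfolding col_space_def using in_own_span by blast
    then show ?thesis using col_space_eq[OF C] CM C by auto
  qed
  then obtain w where w: "\<And>j. j < k \<Longrightarrow> w j \<in> carrier_vec (rk M) \<and> C *\<^sub>v w j = col M j"
    by metis
  define W where "W = mat (rk M) k (\<lambda>(i, j). w j $ i)"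
  have W: "W \<in> carrier_mat (rk M) k" unfolding W_def by simp
  have "M = C * W"
  proof (rule eq_matI)
    fix i j assume "i < dim_row (C * W)" "j < dim_col (C * W)"
    then have i: "i < m" and j: "j < k" using C W by auto
    have "col W j = w j" unfolding W_def using j w[OF j] by (intro eq_vecI) auto
    then have "(C * W) $$ (i, j) = (C *\<^sub>v w j) $ i" using i j C W by simp
    then show "M $$ (i, j) = (C * W) $$ (i, j)" using w[OF j] i j M by simp
  qed (use C W M in auto)
  with C W that show ?thesis by blast
qed

lemma rk_transpose_le:
  fixes M :: "'a::{finite,field} mat"
  assumes M: "M \<in> carrier_mat m k"
  shows "rk M\<^sup>T \<le> rk M"
proof -
  obtain C W where C: "C \<in> carrier_mat m (rk M)" and W: "W \<in> carrier_mat (rk M) k"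
    and MCW: "M = C * W"
    using rank_factorization[OF M] .
  have "M\<^sup>T = W\<^sup>T * C\<^sup>T" unfolding MCW using C W by (simp add: transpose_mult)
  then have "mat_image M\<^sup>T \<subseteq> mat_image W\<^sup>T"
    using mat_image_mult_subset[of "W\<^sup>T" k "rk M" "C\<^sup>T" m] C W by simp
  then have "rk M\<^sup>T \<le> rk W\<^sup>T"
    using subdim_mono is_subspace_mat_image[of "M\<^sup>T"] is_subspace_mat_image[of "W\<^sup>T"] M W
    unfolding rk_eq_subdim_mat_image by simp
  also have "\<dots> \<le> rk M"
    using vec_space.rank_le_nc[of "W\<^sup>T" k "rk M"] W unfolding rk_def by simp
  finally show ?thesis .
qed

lemma rk_transpose:
  fixes M :: "'a::{finite,field} mat"
  shows "rk M\<^sup>T = rk M"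
proof -
  have M: "M \<in> carrier_mat (dim_row M) (dim_col M)" by simp
  show ?thesis
    using rk_transpose_le[OF M] rk_transpose_le[of "M\<^sup>T" "dim_col M" "dim_row M"] by simp
qed

lemma subdim_row_sp:
  fixes X :: "'a::{finite,field} mat"
  assumes "X \<in> carrier_mat r n"
  shows "subdim n (row_sp n X) = rk X"
  using assms rk_eq_subdim_mat_image[of "X\<^sup>T"] rk_transpose[of X]
  unfolding row_sp_eq_mat_image_transpose[OF assms] by simp

lemma image_mat_image:
  assumes "A \<in> carrier_mat m k" "B \<in> carrier_mat k l"
  shows "(*\<^sub>v) A ` mat_image B = mat_image (A * B)"
  using assms unfolding mat_image_def image_image
  by (intro image_cong) (auto simp: assoc_mult_mat_vec)

lemma is_subspace_mat_kernel:
  assumes H: "H \<in> carrier_mat m n"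
  shows "is_subspace n (mat_kernel (H :: 'a::field mat))"
proof -
  interpret vec_space "TYPE('a)" n .
  have "H *\<^sub>v 0\<^sub>v n = 0\<^sub>v m" using H by (intro eq_vecI) auto
  then show ?thesis
    unfolding is_subspace_def
    by (intro subspace.intro vectorspace_axioms submodule.intro module_axioms)
      (auto simp: mat_kernel[OF H] module_vec_simps mult_add_distrib_mat_vec[OF H] mult_mat_vec[OF H])
qed

lemma subdim_mat_kernel_plus:
  fixes H :: "'a::{finite,field} mat"
  assumes H: "H \<in> carrier_mat m n" and V: "is_subspace n V"
  shows "subdim n (subspace_plus (mat_kernel H) V) = subdim n (mat_kernel H) + subdim m ((*\<^sub>v) H ` V)"
proof -
  let ?K = "mat_kernel H"
  have K: "is_subspace n ?K" by (rule is_subspace_mat_kernel[OF H])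
  have K0: "H *\<^sub>v u = 0\<^sub>v m" and Kc: "u \<in> carrier_vec n" if "u \<in> ?K" for u
    using mat_kernelD[OF H that] by auto
  have Vc: "V \<subseteq> carrier_vec n" and V0: "0\<^sub>v n \<in> V"
    using subspace_subset_carrier[OF V] zero_in_subspace[OF V] .
  have "{v \<in> subspace_plus ?K V. H *\<^sub>v v = 0\<^sub>v m} = ?K"
  proof (intro equalityI subsetI)
    fix v assume "v \<in> {v \<in> subspace_plus ?K V. H *\<^sub>v v = 0\<^sub>v m}"
    then show "v \<in> ?K"
      using subspace_subset_carrier[OF is_subspace_subspace_plus[OF K V]] H
      by (auto intro: mat_kernelI)
  next
    fix u assume "u \<in> ?K"
    moreover have "u = u + 0\<^sub>v n" using Kc[OF \<open>u \<in> ?K\<close>] by simp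
    ultimately show "u \<in> {v \<in> subspace_plus ?K V. H *\<^sub>v v = 0\<^sub>v m}"
      unfolding subspace_plus_def using V0 K0 by blast
  qed
  moreover have "(*\<^sub>v) H ` subspace_plus ?K V = (*\<^sub>v) H ` V"
  proof (intro equalityI subsetI)
    fix y assume "y \<in> (*\<^sub>v) H ` subspace_plus ?K V"
    then obtain u v where "u \<in> ?K" "v \<in> V" "y = H *\<^sub>v (u + v)"
      unfolding subspace_plus_def by auto
    moreover then have "H *\<^sub>v (u + v) = H *\<^sub>v v"
      using mult_add_distrib_mat_vec[OF H Kc] K0 Vc H by auto
    ultimately show "y \<in> (*\<^sub>v) H ` V" by simp
  next
    fix y assume "y \<in> (*\<^sub>v) H ` V"
    then obtain v where "v \<in> V" "y = H *\<^sub>v v" by auto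
    moreover then have "v = 0\<^sub>v n + v" using Vc by auto
    ultimately show "y \<in> (*\<^sub>v) H ` subspace_plus ?K V"
      unfolding subspace_plus_def using zero_in_subspace[OF K] by blast
  qed
  ultimately show ?thesis
    using subdim_mat_image_plus_kernel[OF H is_subspace_subspace_plus[OF K V]] by simp
qed

definition check_mat :: "nat \<Rightarrow> nat \<Rightarrow> nat \<Rightarrow> 'a::field mat" where
  "check_mat r n d = mat (n - r) n
     (\<lambda>(j, i). (if i = r + j then 1 else 0) - (if i = j \<and> j < d then 1 else 0))"

lemma check_mat_carrier: "check_mat r n d \<in> carrier_mat (n - r) n"
  unfolding check_mat_def by simp

lemma dim_check_mat [simp]: "dim_row (check_mat r n d) = n - r" "dim_col (check_mat r n d) = n"
  unfolding check_mat_def by simp_all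

lemma row_check_mat_scalar_prod:
  assumes v: "v \<in> carrier_vec n" and j: "j < n - r"
  shows "row (check_mat r n d) j \<bullet> v = v $ (r + j) - (if j < d then v $ j else 0)"
proof -
  have "row (check_mat r n d) j \<bullet> v
      = (\<Sum>i\<in>{0..<n}. (if i = r + j then v $ i else 0) - (if i = j \<and> j < d then v $ i else 0))"
    using v j unfolding check_mat_def scalar_prod_def by (intro sum.cong) (auto simp: left_diff_distrib)
  also have "\<dots> = v $ (r + j) - (if j < d then v $ j else 0)"
    using j by (simp add: sum_subtractf less_diff_conv)
  finally show ?thesis .
qed

lemma mult_check_mat_transpose_index:
  assumes X: "X \<in> carrier_mat m n" and i: "i < m" and j: "j < n - r"
  shows "(X * (check_mat r n d)\<^sup>T) $$ (i, j) = X $$ (i, r + j) - (if j < d then X $$ (i, j) else 0)"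
proof -
  have H: "check_mat r n d \<in> carrier_mat (n - r) n" by (rule check_mat_carrier)
  have "(X * (check_mat r n d)\<^sup>T) $$ (i, j) = row X i \<bullet> row (check_mat r n d) j"
    using X H i j by (subst index_mult_mat) auto
  also have "\<dots> = row (check_mat r n d) j \<bullet> row X i"
    using row_carrier[of X i] row_carrier[of "check_mat r n d" j] X
    by (intro comm_scalar_prod[of _ n]) auto
  finally show ?thesis
    using row_check_mat_scalar_prod[of "row X i" n j r d] X i j by auto
qed

lemma hconcat_index:
  assumes "i < dim_row A" "j < dim_col A + dim_col B"
  shows "hconcat A B $$ (i, j) = (if j < dim_col A then A $$ (i, j) else B $$ (i, j - dim_col A))"
  using assms unfolding hconcat_def by simp

lemma dim_hconcat [simp]:
  "dim_row (hconcat A B) = dim_row A" "dim_col (hconcat A B) = dim_col A + dim_col B"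
  unfolding hconcat_def by simp_all

lemma transpose_hconcat_one_P_mult_vec:
  fixes z :: "'a::field vec"
  assumes z: "z \<in> carrier_vec r" and dr: "d \<le> r" and rn: "r \<le> n"
  shows "(hconcat (1\<^sub>m r) (P_mat r n d))\<^sup>T *\<^sub>v z
       = vec n (\<lambda>i. if i < r then z $ i else if i - r < d then z $ (i - r) else 0)"
proof (rule eq_vecI)
  fix i assume "i < dim_vec (vec n (\<lambda>i. if i < r then z $ i else if i - r < d then z $ (i - r) else 0))"
  then have i: "i < n" by simp
  let ?k = "if i < r then i else i - r"
  have "((hconcat (1\<^sub>m r) (P_mat r n d))\<^sup>T *\<^sub>v z) $ i
      = (\<Sum>k\<in>{0..<r}. hconcat (1\<^sub>m r) (P_mat r n d) $$ (k, i) * z $ k)"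
    using z i rn by (simp add: scalar_prod_def P_mat_def)
  also have "\<dots> = (\<Sum>k\<in>{0..<r}. if k = ?k \<and> (i < r \<or> i - r < d) then z $ k else 0)"
    using i rn by (intro sum.cong) (auto simp: hconcat_index P_mat_def)
  also have "\<dots> = (if i < r then z $ i else if i - r < d then z $ (i - r) else 0)"
    using dr i by (auto simp: sum.delta')
  finally show "((hconcat (1\<^sub>m r) (P_mat r n d))\<^sup>T *\<^sub>v z) $ i
      = vec n (\<lambda>i. if i < r then z $ i else if i - r < d then z $ (i - r) else 0) $ i"
    using i by simp
qed (simp add: P_mat_def rn)

lemma mat_kernel_check_mat:
  "mat_kernel (check_mat r n d :: 'a::field mat)
     = {v \<in> carrier_vec n. \<forall>j < n - r. v $ (r + j) = (if j < d then v $ j else 0)}"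
proof -
  have "check_mat r n d *\<^sub>v v = 0\<^sub>v (n - r)
        \<longleftrightarrow> (\<forall>j < n - r. v $ (r + j) = (if j < d then v $ j else 0))"
    if v: "v \<in> carrier_vec n" for v :: "'a vec"
  proof -
    have "check_mat r n d *\<^sub>v v = 0\<^sub>v (n - r) \<longleftrightarrow> (\<forall>j < n - r. (check_mat r n d *\<^sub>v v) $ j = 0)"
      by (auto simp: vec_eq_iff)
    then show ?thesis by (simp add: row_check_mat_scalar_prod[OF v])
  qed
  then show ?thesis unfolding mat_kernel[OF check_mat_carrier] by blast
qed

lemma U_sub_eq_mat_kernel:
  assumes dr: "d \<le> r" and rn: "r \<le> n"
  shows "U_sub r n d = mat_kernel (check_mat r n d :: 'a::field mat)"
proof -
  let ?Y = "hconcat (1\<^sub>m r) (P_mat r n d) :: 'a mat"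
  let ?v = "\<lambda>z :: 'a vec. vec n (\<lambda>i. if i < r then z $ i else if i - r < d then z $ (i - r) else 0)"
  have Y: "?Y \<in> carrier_mat r n" using rn by (simp add: P_mat_def carrier_matI)
  have "U_sub r n d = (*\<^sub>v) ?Y\<^sup>T ` carrier_vec r"
    unfolding U_sub_def row_sp_eq_mat_image_transpose[OF Y] mat_image_def by simp
  also have "\<dots> = ?v ` carrier_vec r"
    using transpose_hconcat_one_P_mult_vec[OF _ dr rn] by (intro image_cong) auto
  also have "\<dots> = mat_kernel (check_mat r n d)"
  proof (intro equalityI subsetI)
    fix v :: "'a vec" assume "v \<in> ?v ` carrier_vec r"
    then show "v \<in> mat_kernel (check_mat r n d)"
      using dr unfolding mat_kernel_check_mat by auto
  next
    fix v :: "'a vec" assume "v \<in> mat_kernel (check_mat r n d)"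
    then have v: "v \<in> carrier_vec n"
      and ker: "\<And>j. j < n - r \<Longrightarrow> v $ (r + j) = (if j < d then v $ j else 0)"
      unfolding mat_kernel_check_mat by auto
    have "v = ?v (vec r (($) v))"
    proof (rule eq_vecI)
      fix i assume "i < dim_vec (?v (vec r (($) v)))"
      then have i: "i < n" by simp
      show "v $ i = ?v (vec r (($) v)) $ i"
      proof (cases "i < r")
        case False
        then have "v $ i = (if i - r < d then v $ (i - r) else 0)" using ker[of "i - r"] i by simp
        then show ?thesis using False dr i by simp
      qed (use i in simp)
    qed (use v in simp)
    then show "v \<in> ?v ` carrier_vec r" by (rule image_eqI) simp
  qed
  finally show ?thesis .
qed

lemma image_check_mat:
  assumes dr: "d \<le> r"
  shows "(*\<^sub>v) (check_mat r n d :: 'a::field mat) ` carrier_vec n = carrier_vec (n - r)"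
proof (intro equalityI subsetI)
  fix w :: "'a vec" assume w: "w \<in> carrier_vec (n - r)"
  define v where "v = vec n (\<lambda>i. if i < r then 0 else w $ (i - r))"
  have "check_mat r n d *\<^sub>v v = w"
    using w dr by (intro eq_vecI) (auto simp: row_check_mat_scalar_prod v_def)
  moreover have "v \<in> carrier_vec n" unfolding v_def by simp
  ultimately show "w \<in> (*\<^sub>v) (check_mat r n d) ` carrier_vec n" by (metis image_eqI)
qed (auto intro: carrier_vecI)

lemma subdim_U_sub:
  assumes dr: "d \<le> r" and rn: "r \<le> n"
  shows "subdim n (U_sub r n d :: 'a::{finite,field} vec set) = r"
proof -
  have "subdim (n - r) ((*\<^sub>v) (check_mat r n d :: 'a mat) ` carrier_vec n)
      + subdim n (mat_kernel (check_mat r n d :: 'a mat)) = n"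
    using subdim_mat_image_plus_kernel[OF check_mat_carrier is_subspace_carrier_vec]
    unfolding mat_kernel[OF check_mat_carrier] subdim_carrier_vec .
  then show ?thesis
    using rn unfolding image_check_mat[OF dr] subdim_carrier_vec U_sub_eq_mat_kernel[OF dr rn] by simp
qed

lemma subdim_U_sub_plus_row_sp:
  fixes X :: "'a::{finite,field} mat"
  assumes X: "X \<in> carrier_mat m n" and dr: "d \<le> r" and rn: "r \<le> n"
  shows "subdim n (subspace_plus (U_sub r n d) (row_sp n X)) = r + rk (X * (check_mat r n d)\<^sup>T)"
proof -
  let ?H = "check_mat r n d :: 'a mat"
  have XH: "X * ?H\<^sup>T \<in> carrier_mat m (n - r)"
    using X by (intro mult_carrier_mat) (auto simp: check_mat_carrier)
  have V: "row_sp n X = mat_image X\<^sup>T" by (rule row_sp_eq_mat_image_transpose[OF X])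
  have "X\<^sup>T \<in> carrier_mat n m" using X by simp
  then have "(*\<^sub>v) ?H ` row_sp n X = mat_image (?H * X\<^sup>T)"
    unfolding V by (rule image_mat_image[OF check_mat_carrier])
  also have "\<dots> = mat_image (X * ?H\<^sup>T)\<^sup>T"
    using transpose_mult[OF X, of "?H\<^sup>T" "n - r"] by (simp add: check_mat_carrier)
  finally have image: "subdim (n - r) ((*\<^sub>v) ?H ` row_sp n X) = rk (X * ?H\<^sup>T)"
    using rk_eq_subdim_mat_image[of "(X * ?H\<^sup>T)\<^sup>T"] XH by (simp add: rk_transpose)
  have "is_subspace n (row_sp n X)"
    unfolding V using is_subspace_mat_image[of "X\<^sup>T"] X by simp
  from subdim_mat_kernel_plus[OF check_mat_carrier this] show ?thesis
    using image subdim_U_sub[OF dr rn] unfolding U_sub_eq_mat_kernel[OF dr rn] by simp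
qed

lemma row_sp_in_inj_ball_U_sub_iff:
  fixes X :: "'a::{finite,field} mat"
  assumes X: "X \<in> carrier_mat r n" and rk: "rk X = r" and dr: "d \<le> r" and rn: "r \<le> n"
  shows "row_sp n X \<in> inj_ball r n t (U_sub r n d) \<longleftrightarrow> rk (X * (check_mat r n d)\<^sup>T) \<le> t"
proof -
  have "is_subspace n (row_sp n X)"
    using is_subspace_mat_image[of "X\<^sup>T"] X unfolding row_sp_eq_mat_image_transpose[OF X] by simp
  then show ?thesis
    unfolding inj_ball_def Grass_def inj_dist_def
    using subdim_row_sp[OF X] rk subdim_U_sub_plus_row_sp[OF X dr rn]
    by (simp add: subdim_U_sub[OF dr rn])
qed

lemma col_slice_eq_mult_check_mat:
  assumes X: "X \<in> carrier_mat m n"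
  shows "col_slice X r n = X * (check_mat r n 0)\<^sup>T"
  using X by (intro eq_matI)
    (auto simp: carrier_matD col_slice_def mult_check_mat_transpose_index simp del: index_mult_mat(1))

lemma hconcat_diff_eq_mult_check_mat:
  fixes X :: "'a::field mat"
  assumes X: "X \<in> carrier_mat m n" and d: "1 \<le> d" "d \<le> r" "d \<le> n - r"
  shows "hconcat (hconcat (col_slice (col_slice X r n) 0 (d - 1) - col_slice (col_slice X 0 r) 0 (d - 1))
           (mat_of_cols m [col (col_slice X r n) (d - 1) - col (col_slice X 0 r) (d - 1)]))
           (col_slice (col_slice X r n) d (n - r))
       = X * (check_mat r n d)\<^sup>T"
    (is "?H = _")
proof (rule eq_matI)
  fix i j assume "i < dim_row (X * (check_mat r n d)\<^sup>T)" "j < dim_col (X * (check_mat r n d)\<^sup>T)"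
  then have i: "i < m" and j: "j < n - r" using X by auto
  consider "j < d - 1" | "j = d - 1" | "d \<le> j" by linarith
  then show "?H $$ (i, j) = (X * (check_mat r n d)\<^sup>T) $$ (i, j)"
    by cases (use X d i j in \<open>auto simp: hconcat_index col_slice_def
        mult_check_mat_transpose_index mat_of_cols_index simp del: index_mult_mat(1)\<close>)
qed (use X d in \<open>auto simp: col_slice_def\<close>)

theorem lemma10:
  fixes X :: "'a::{finite,field} mat" and r n u s d :: nat
  assumes "r \<le> n div 2" and "u \<le> r" and "s \<le> r" and "1 \<le> d" and "d \<le> r"
    and "X \<in> carrier_mat r n"
  shows "X \<in> F_set r n u s d \<longleftrightarrow>
    (let A = col_slice X 0 r; B = col_slice X r n;
         A1 = col_slice A 0 (d - 1); a = col A (d - 1);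
         B1 = col_slice B 0 (d - 1); b = col B (d - 1); B2 = col_slice B d (n - r)
     in rk X = r \<and> rk B \<le> u \<and>
        rk (hconcat (hconcat (B1 - A1) (mat_of_cols r [b - a])) B2) \<le> s)"
proof -
  note X = \<open>X \<in> carrier_mat r n\<close>
  have rn: "r \<le> n" and dnr: "d \<le> n - r" using assms(1,5) by linarith+
  have "X \<in> F_set r n u s d \<longleftrightarrow>
      rk X = r \<and> rk (X * (check_mat r n 0)\<^sup>T) \<le> u \<and> rk (X * (check_mat r n d)\<^sup>T) \<le> s"
    unfolding F_set_def using row_sp_in_inj_ball_U_sub_iff[OF X _ _ rn] X assms(5) by auto
  then show ?thesis
    unfolding Let_def
    by (subst hconcat_diff_eq_mult_check_mat[OF X assms(4,5) dnr], subst col_slice_eq_mult_check_mat[OF X])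
qed

end
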